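(* Let $n$ be a positive integer and let $\alpha\in IS_{n}$ with $\operatorname{rank}(\alpha)=r$. Then: (1) $\alpha IS_{n}\alpha \cong IS_{r}^{c}$ for some $c\in IS_{r}$ with $\operatorname{rank}(c)=\operatorname{rank}(\alpha^{2})$. (2) $IS_{n}^{\alpha} \cong \beta IS_{2n-r}\beta$ for some $\beta\in IS_{2n-r}$ with $\operatorname{rank}(\beta)=n$ and $\operatorname{rank}(\beta^{2})=r$. Here $\cong$ denotes isomorphism of semigroups.
   Context: For a non-negative integer $k$, $IS_k$ denotes the symmetric inverse monoid on $\{1,\dots,k\}$: the set of all partial bijections (bijections from a subset of $\{1,\dots,k\}$ to a subset of $\{1,\dots,k\}$, including the empty map) under composition of partial maps. The rank of a partial bijection is the cardinality of its range; the empty map has rank $0$. For a semigroup $S$ and $a\in S$, the local subsemigroup of $S$ with respect to $a$ is the subsemigroup $aSa=\{axa : x\in S\}$ with the multiplication of $S$, and the variant of $S$ with respect to $a$, denoted $S^{a}$, is the semigroup with underlying set $S$ and operation $x\star_a y = xay$. *)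

theory Defs
  imports "HOL-Algebra.Group"
begin

definition partial_bijections :: "nat \<Rightarrow> (nat \<rightharpoonup> nat) set"
  where "partial_bijections k =
    {f. dom f \<subseteq> {1..k} \<and> ran f \<subseteq> {1..k} \<and> inj_on f (dom f)}"

text \<open>Products are read as \<open>f \<circ>\<^sub>m g\<close>, i.e. \<open>g\<close> is applied first.\<close>

definition IS :: "nat \<Rightarrow> (nat \<rightharpoonup> nat) monoid"
  where "IS k = \<lparr>carrier = partial_bijections k, mult = (\<circ>\<^sub>m), one = Some |` {1..k}\<rparr>"

definition rank :: "('a \<rightharpoonup> 'b) \<Rightarrow> nat"
  where "rank f = card (ran f)"

text \<open>
  The next two constructions are in general only semigroups. They are represented by the
  record type \<open>monoid\<close>, whose \<open>one\<close> field is inherited from \<open>S\<close> and carries no meaning: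
  the relation \<open>\<cong>\<close> of \<open>HOL-Algebra\<close> depends only on \<open>carrier\<close> and \<open>mult\<close>, so
  it is isomorphism of semigroups.
\<close>

definition local_subsemigroup :: "('a, 'b) monoid_scheme \<Rightarrow> 'a \<Rightarrow> ('a, 'b) monoid_scheme"
  where "local_subsemigroup S a =
    S\<lparr>carrier := {a \<otimes>\<^bsub>S\<^esub> x \<otimes>\<^bsub>S\<^esub> a | x. x \<in> carrier S}\<rparr>"

definition variant :: "('a, 'b) monoid_scheme \<Rightarrow> 'a \<Rightarrow> ('a, 'b) monoid_scheme"
  where "variant S a = S\<lparr>mult := \<lambda>x y. x \<otimes>\<^bsub>S\<^esub> a \<otimes>\<^bsub>S\<^esub> y\<rparr>"

lemma monoid_IS: "monoid (IS k)"
proof (rule monoidI)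
  fix f g assume "f \<in> carrier (IS k)" "g \<in> carrier (IS k)"
  then have f: "dom f \<subseteq> {1..k}" "ran f \<subseteq> {1..k}" "inj_on f (dom f)"
    and g: "dom g \<subseteq> {1..k}" "ran g \<subseteq> {1..k}" "inj_on g (dom g)"
    by (auto simp: IS_def partial_bijections_def)
  have "dom (f \<circ>\<^sub>m g) \<subseteq> {1..k}"
    using g(1) by (auto simp: map_comp_def split: option.splits)
  moreover have "ran (f \<circ>\<^sub>m g) \<subseteq> {1..k}"
    using f(2) by (fastforce simp: map_comp_def ran_def split: option.splits)
  moreover have "inj_on (f \<circ>\<^sub>m g) (dom (f \<circ>\<^sub>m g))"
  proof (rule inj_onI)
    fix x y
    assume x: "x \<in> dom (f \<circ>\<^sub>m g)" and y: "y \<in> dom (f \<circ>\<^sub>m g)" and eq: "(f \<circ>\<^sub>m g) x = (f \<circ>\<^sub>m g) y"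
    obtain u v where u: "g x = Some u" "u \<in> dom f" and v: "g y = Some v" "v \<in> dom f"
      using x y by (auto simp: map_comp_def dom_def split: option.splits)
    with eq have "f u = f v" by (simp add: map_comp_def)
    with u v f(3) have "u = v" by (auto dest: inj_onD)
    with u v g(3) show "x = y" by (simp add: inj_on_def domIff)
  qed
  ultimately show "f \<otimes>\<^bsub>IS k\<^esub> g \<in> carrier (IS k)"
    by (simp add: IS_def partial_bijections_def)
next
  show "\<one>\<^bsub>IS k\<^esub> \<in> carrier (IS k)"
    by (auto simp: IS_def partial_bijections_def ran_def restrict_map_def inj_on_def split: if_splits)
next
  fix f g h
  show "f \<otimes>\<^bsub>IS k\<^esub> g \<otimes>\<^bsub>IS k\<^esub> h = f \<otimes>\<^bsub>IS k\<^esub> (g \<otimes>\<^bsub>IS k\<^esub> h)"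
    by (auto simp: IS_def map_comp_def fun_eq_iff split: option.splits)
next
  fix f assume "f \<in> carrier (IS k)"
  then have f: "dom f \<subseteq> {1..k}" "ran f \<subseteq> {1..k}"
    by (auto simp: IS_def partial_bijections_def)
  show "\<one>\<^bsub>IS k\<^esub> \<otimes>\<^bsub>IS k\<^esub> f = f"
  proof
    fix x
    show "(\<one>\<^bsub>IS k\<^esub> \<otimes>\<^bsub>IS k\<^esub> f) x = f x"
    proof (cases "f x")
      case None then show ?thesis by (simp add: IS_def map_comp_def)
    next
      case (Some y)
      then have "y \<in> {1..k}" using f(2) ranI by fast
      with Some show ?thesis by (simp add: IS_def map_comp_def restrict_map_def)
    qed
  qed
  show "f \<otimes>\<^bsub>IS k\<^esub> \<one>\<^bsub>IS k\<^esub> = f"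
  proof
    fix x
    show "(f \<otimes>\<^bsub>IS k\<^esub> \<one>\<^bsub>IS k\<^esub>) x = f x"
    proof (cases "x \<in> {1..k}")
      case True then show ?thesis by (simp add: IS_def map_comp_def)
    next
      case False
      then have "f x = None" using f(1) by blast
      with False show ?thesis by (simp add: IS_def map_comp_def restrict_map_def)
    qed
  qed
qed

end

theory Submission
  imports Defs
begin

text \<open>
  Both parts come from one factorization argument. Let \<open>p\<close> be a total injection
  from \<open>{1..k}\<close> to \<open>{1..m}\<close>, and let \<open>q\<close> be a partial injection
  from \<open>{1..m}\<close> onto \<open>{1..k}\<close>. Then \<open>y \<mapsto> p y q\<close> is injective, and
  \<open>(p y q) (p z q) = p (y (q p) z) q\<close>, so it embeds the variant of \<open>IS k\<close> with respect to
  \<open>q p\<close> into \<open>IS m\<close>, with image the local subsemigroup of \<open>p q\<close>.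
  For (1), factor \<open>\<alpha> = p q\<close> through a set of size \<open>r\<close>. For (2), write \<open>\<alpha> = q p\<close> with \<open>p\<close> the
  inclusion of \<open>{1..n}\<close> in \<open>{1..2n-r}\<close>, where \<open>q\<close> extends \<open>\<alpha>\<close> by a bijection from the
  \<open>n - r\<close> new points onto the complement of \<open>ran \<alpha>\<close>.
\<close>

section \<open>Partial injections between two sets, and their inverses\<close>

text \<open>Source and target are separate parameters because the factors \<open>p\<close> and
  \<open>q\<close> run between \<open>{1..k}\<close> and \<open>{1..m}\<close>; equal parameters
  give the carrier of \<open>IS k\<close>.\<close>

definition partial_injections :: "'a set \<Rightarrow> 'b set \<Rightarrow> ('a \<rightharpoonup> 'b) set"
  where "partial_injections A B = {f. dom f \<subseteq> A \<and> ran f \<subseteq> B \<and> inj_on f (dom f)}"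

lemma carrier_IS: "carrier (IS k) = partial_injections {1..k} {1..k}"
  by (simp add: IS_def partial_bijections_def partial_injections_def)

lemma mult_IS: "x \<otimes>\<^bsub>IS k\<^esub> y = x \<circ>\<^sub>m y"
  by (simp add: IS_def)

lemma partial_injections_iff:
  "f \<in> partial_injections A B \<longleftrightarrow>
    (\<forall>x y. f x = Some y \<longrightarrow> x \<in> A \<and> y \<in> B) \<and>
    (\<forall>x x' y. f x = Some y \<longrightarrow> f x' = Some y \<longrightarrow> x = x')"
  unfolding partial_injections_def inj_on_def dom_def ran_def by fastforce

lemma map_comp_partial_injections:
  assumes "f \<in> partial_injections B C" "g \<in> partial_injections A B"
  shows "f \<circ>\<^sub>m g \<in> partial_injections A C"
  using assms unfolding partial_injections_iff map_comp_Some_iff by blast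

lemma map_comp_assoc: "(f \<circ>\<^sub>m g) \<circ>\<^sub>m h = f \<circ>\<^sub>m (g \<circ>\<^sub>m h)"
  by (auto simp: map_comp_def fun_eq_iff split: option.splits)

lemma map_comp_restrict_left: "ran f \<subseteq> A \<Longrightarrow> (Some |` A) \<circ>\<^sub>m f = f"
  by (auto simp: map_comp_def restrict_map_def fun_eq_iff ran_def split: option.splits)

lemma map_comp_restrict_right: "dom f \<subseteq> A \<Longrightarrow> f \<circ>\<^sub>m (Some |` A) = f"
proof
  fix x
  assume "dom f \<subseteq> A"
  then have "f x = None" if "x \<notin> A"
    using that by blast
  then show "(f \<circ>\<^sub>m (Some |` A)) x = f x"
    by (cases "x \<in> A") (simp_all add: map_comp_def)
qed

text \<open>The choice makes sense for every map; for injective \<open>f\<close> each fibre over the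
  range is a single point, and the result is the inverse partial injection.\<close>

definition map_inverse :: "('a \<rightharpoonup> 'b) \<Rightarrow> ('b \<rightharpoonup> 'a)"
  where "map_inverse f y = (if y \<in> ran f then Some (SOME x. f x = Some y) else None)"

lemma dom_map_inverse: "dom (map_inverse f) = ran f"
  by (simp add: map_inverse_def dom_def)

lemma map_inverse_eq_Some_iff:
  assumes "f \<in> partial_injections A B"
  shows "map_inverse f y = Some x \<longleftrightarrow> f x = Some y"
proof
  assume "map_inverse f y = Some x"
  then show "f x = Some y"
    by (auto simp: map_inverse_def ran_def split: if_splits intro: someI)
next
  assume "f x = Some y"
  moreover from this have "(SOME x. f x = Some y) = x"
    using assms unfolding partial_injections_iff by blast
  ultimately show "map_inverse f y = Some x"
    by (auto simp: map_inverse_def ran_def)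
qed

lemma map_inverse_partial_injections:
  assumes "f \<in> partial_injections A B"
  shows "map_inverse f \<in> partial_injections B A"
  using assms unfolding partial_injections_iff map_inverse_eq_Some_iff[OF assms] by auto

lemma map_comp_map_inverse_left:
  assumes "f \<in> partial_injections A B"
  shows "map_inverse f \<circ>\<^sub>m f = Some |` dom f"
proof
  fix x
  show "(map_inverse f \<circ>\<^sub>m f) x = (Some |` dom f) x"
    using map_inverse_eq_Some_iff[OF assms]
    by (cases "f x") (auto simp: restrict_map_def)
qed

lemma map_comp_map_inverse_right:
  assumes "f \<in> partial_injections A B"
  shows "f \<circ>\<^sub>m map_inverse f = Some |` ran f"
proof
  fix y
  show "(f \<circ>\<^sub>m map_inverse f) y = (Some |` ran f) y"
    using map_inverse_eq_Some_iff[OF assms, of y]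
    by (cases "map_inverse f y") (auto simp: restrict_map_def ran_def)
qed

section \<open>Ranks and ranges of composites\<close>

text \<open>Being defined and injective on all of \<open>ran f\<close>, \<open>p\<close> carries
  this set bijectively onto \<open>ran (p \<circ>\<^sub>m f)\<close>.\<close>

lemma rank_comp_injection:
  assumes "p \<in> partial_injections A B" "ran f \<subseteq> dom p"
  shows "rank (p \<circ>\<^sub>m f) = rank f"
proof -
  have "bij_betw (the \<circ> p) (ran f) (ran (p \<circ>\<^sub>m f))"
    unfolding bij_betw_def
  proof
    show "inj_on (the \<circ> p) (ran f)"
    proof (rule inj_onI)
      fix x y assume xy: "x \<in> ran f" "y \<in> ran f" and eq: "(the \<circ> p) x = (the \<circ> p) y"
      obtain u v where "p x = Some u" "p y = Some v"
        using xy assms(2) by blast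
      with eq assms(1) show "x = y"
        unfolding partial_injections_iff by auto
    qed
    show "(the \<circ> p) ` ran f = ran (p \<circ>\<^sub>m f)"
    proof (intro equalityI subsetI)
      fix z assume "z \<in> (the \<circ> p) ` ran f"
      then obtain x y where "f x = Some y" "z = the (p y)"
        by (auto simp: ran_def)
      moreover from this have "y \<in> dom p"
        using assms(2) by (blast intro: ranI)
      ultimately have "(p \<circ>\<^sub>m f) x = Some z" by auto
      then show "z \<in> ran (p \<circ>\<^sub>m f)" by (rule ranI)
    next
      fix z assume "z \<in> ran (p \<circ>\<^sub>m f)"
      then obtain x y where "f x = Some y" "p y = Some z"
        by (auto simp: ran_def map_comp_Some_iff)
      then show "z \<in> (the \<circ> p) ` ran f"
        by (force simp: ran_def)
    qed
  qed
  then show ?thesis by (simp add: rank_def bij_betw_same_card)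
qed

text \<open>Every argument of \<open>f\<close> is a value of \<open>q\<close>, so precomposition
  with \<open>q\<close> loses no value of \<open>f\<close>.\<close>

lemma ran_comp_surjection: "dom f \<subseteq> ran q \<Longrightarrow> ran (f \<circ>\<^sub>m q) = ran f"
  by (fastforce simp: ran_def map_comp_Some_iff)

section \<open>Inverting an isomorphism of semigroups\<close>

text \<open>For the inverse \<open>g\<close> of \<open>h\<close>, the map \<open>h\<close> sends the
  product of \<open>g x\<close> and \<open>g y\<close> to the product of \<open>x\<close> and
  \<open>y\<close>. Closure of \<open>G\<close> keeps the former product in the carrier, where
  \<open>g\<close> undoes \<open>h\<close>.\<close>

lemma semigroup_iso_sym:
  assumes "G \<cong> H" "\<And>x y. x \<in> carrier G \<Longrightarrow> y \<in> carrier G \<Longrightarrow> x \<otimes>\<^bsub>G\<^esub> y \<in> carrier G"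
  shows "H \<cong> G"
proof -
  obtain h where h: "h \<in> hom G H" "bij_betw h (carrier G) (carrier H)"
    using assms(1) by (auto simp: is_iso_def iso_def)
  define g where "g = inv_into (carrier G) h"
  have g: "bij_betw g (carrier H) (carrier G)"
    using h(2) by (simp add: g_def bij_betw_inv_into)
  have "g (x \<otimes>\<^bsub>H\<^esub> y) = g x \<otimes>\<^bsub>G\<^esub> g y" if "x \<in> carrier H" "y \<in> carrier H" for x y
  proof -
    have mem: "g x \<in> carrier G" "g y \<in> carrier G"
      using g that by (auto dest: bij_betwE)
    have "h (g x \<otimes>\<^bsub>G\<^esub> g y) = x \<otimes>\<^bsub>H\<^esub> y"
      using h that mem by (simp add: hom_mult g_def bij_betw_inv_into_right)
    then show ?thesis
      using bij_betw_inv_into_left[OF h(2)] assms(2)[OF mem] by (metis g_def)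
  qed
  then have "g \<in> hom H G"
    using g by (auto simp: hom_def dest: bij_betwE)
  with g show ?thesis by (auto simp: is_iso_def iso_def)
qed

section \<open>Variant and local subsemigroup attached to a pair of factors\<close>

text \<open>Totality of \<open>p\<close> makes it left cancellable, and surjectivity of
  \<open>q\<close> makes it right cancellable, for elements of \<open>IS k\<close>. The outer
  product \<open>p q\<close> lives in \<open>IS m\<close>, the inner product \<open>q p\<close> in
  \<open>IS k\<close>.\<close>

locale factorization =
  fixes k m :: nat and p q :: "nat \<rightharpoonup> nat"
  assumes p: "p \<in> partial_injections {1..k} {1..m}" "dom p = {1..k}"
    and q: "q \<in> partial_injections {1..m} {1..k}" "ran q = {1..k}"
begin

lemma outer_product_closed: "p \<circ>\<^sub>m q \<in> carrier (IS m)"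
  unfolding carrier_IS using p(1) q(1) by (rule map_comp_partial_injections)

lemma inner_product_closed: "q \<circ>\<^sub>m p \<in> carrier (IS k)"
  unfolding carrier_IS using q(1) p(1) by (rule map_comp_partial_injections)

lemma rank_outer_product: "rank (p \<circ>\<^sub>m q) = k"
proof -
  have "rank (p \<circ>\<^sub>m q) = rank q"
    using p q by (intro rank_comp_injection) auto
  then show ?thesis using q(2) by (simp add: rank_def)
qed

text \<open>Regroup \<open>(p q) (p q)\<close> as \<open>p ((q p) q)\<close>: the injection
  \<open>p\<close> on the left preserves the rank, and \<open>q\<close> on the right, being onto,
  preserves the range.\<close>

lemma rank_outer_product_square: "rank ((p \<circ>\<^sub>m q) \<circ>\<^sub>m (p \<circ>\<^sub>m q)) = rank (q \<circ>\<^sub>m p)"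
proof -
  have c: "dom (q \<circ>\<^sub>m p) \<subseteq> {1..k}" "ran (q \<circ>\<^sub>m p) \<subseteq> {1..k}"
    using inner_product_closed by (auto simp: carrier_IS partial_injections_def)
  have "rank ((p \<circ>\<^sub>m q) \<circ>\<^sub>m (p \<circ>\<^sub>m q)) = rank (p \<circ>\<^sub>m ((q \<circ>\<^sub>m p) \<circ>\<^sub>m q))"
    by (simp only: map_comp_assoc)
  also have "\<dots> = rank ((q \<circ>\<^sub>m p) \<circ>\<^sub>m q)"
    using p c q(2) by (intro rank_comp_injection) (simp_all add: ran_comp_surjection)
  also have "\<dots> = rank (q \<circ>\<^sub>m p)"
    using c q(2) by (simp add: rank_def ran_comp_surjection)
  finally show ?thesis .
qed

lemma variant_iso_local: "variant (IS k) (q \<circ>\<^sub>m p) \<cong> local_subsemigroup (IS m) (p \<circ>\<^sub>m q)"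
proof -
  let ?p' = "map_inverse p" and ?q' = "map_inverse q"
  let ?I = "partial_injections {1..k} {1..k}"
  let ?L = "{(p \<circ>\<^sub>m q) \<circ>\<^sub>m x \<circ>\<^sub>m (p \<circ>\<^sub>m q) |x. x \<in> partial_injections {1..m} {1..m}}"
  define \<phi> where "\<phi> y = p \<circ>\<^sub>m (y \<circ>\<^sub>m q)" for y
  note p' = map_inverse_partial_injections[OF p(1)]
  note q' = map_inverse_partial_injections[OF q(1)]
  \<comment> \<open>Both \<open>?p' p\<close> and \<open>q ?q'\<close> are the identity on
    \<open>{1..k}\<close>, so stripping off \<open>p\<close> and \<open>q\<close> recovers
    \<open>y\<close>.\<close>
  have cancel: "?p' \<circ>\<^sub>m (p \<circ>\<^sub>m (y \<circ>\<^sub>m (q \<circ>\<^sub>m ?q'))) = y" if "y \<in> ?I" for y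
  proof -
    have y: "dom y \<subseteq> {1..k}" "ran y \<subseteq> {1..k}"
      using that by (auto simp: partial_injections_def)
    have "?p' \<circ>\<^sub>m (p \<circ>\<^sub>m (y \<circ>\<^sub>m (q \<circ>\<^sub>m ?q'))) = (?p' \<circ>\<^sub>m p) \<circ>\<^sub>m (y \<circ>\<^sub>m (q \<circ>\<^sub>m ?q'))"
      by (simp only: map_comp_assoc)
    also have "\<dots> = y"
      using y p(2) q(2)
      by (simp only: map_comp_map_inverse_left[OF p(1)] map_comp_map_inverse_right[OF q(1)]
          map_comp_restrict_left map_comp_restrict_right)
    finally show ?thesis .
  qed
  have "inj_on \<phi> ?I"
    using cancel by (intro inj_on_inverseI[where g = "\<lambda>z. ?p' \<circ>\<^sub>m (z \<circ>\<^sub>m ?q')"])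
      (simp add: \<phi>_def map_comp_assoc)
  moreover have "\<phi> ` ?I = ?L"
  proof (intro equalityI subsetI)
    fix z assume "z \<in> \<phi> ` ?I"
    then obtain y where y: "y \<in> ?I" "z = \<phi> y" by blast
    \<comment> \<open>This \<open>x\<close> is chosen so that \<open>(p q) x (p q)\<close> regroups
      as \<open>p ((q ?q') y (?p' p)) q\<close>, where the inner pairs are identities on
      \<open>{1..k}\<close>.\<close>
    define x where "x = ?q' \<circ>\<^sub>m (y \<circ>\<^sub>m ?p')"
    have "x \<in> partial_injections {1..m} {1..m}"
      unfolding x_def using p' q' y(1) by (intro map_comp_partial_injections)
    moreover have "(p \<circ>\<^sub>m q) \<circ>\<^sub>m x \<circ>\<^sub>m (p \<circ>\<^sub>m q) = z"
    proof -
      have "dom y \<subseteq> {1..k}" "ran y \<subseteq> {1..k}"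
        using y(1) by (auto simp: partial_injections_def)
      then have "y = (q \<circ>\<^sub>m ?q') \<circ>\<^sub>m y \<circ>\<^sub>m (?p' \<circ>\<^sub>m p)"
        using p(2) q(2)
        by (simp only: map_comp_map_inverse_left[OF p(1)] map_comp_map_inverse_right[OF q(1)]
            map_comp_restrict_left map_comp_restrict_right)
      then have "z = p \<circ>\<^sub>m (((q \<circ>\<^sub>m ?q') \<circ>\<^sub>m y \<circ>\<^sub>m (?p' \<circ>\<^sub>m p)) \<circ>\<^sub>m q)"
        unfolding y(2) \<phi>_def by simp
      then show ?thesis by (simp only: x_def map_comp_assoc)
    qed
    ultimately show "z \<in> ?L" by blast
  next
    fix z assume "z \<in> ?L"
    then obtain x where x: "x \<in> partial_injections {1..m} {1..m}"
      and z: "z = (p \<circ>\<^sub>m q) \<circ>\<^sub>m x \<circ>\<^sub>m (p \<circ>\<^sub>m q)" by blast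
    have "z = \<phi> (q \<circ>\<^sub>m (x \<circ>\<^sub>m p))"
      by (simp only: z \<phi>_def map_comp_assoc)
    moreover have "q \<circ>\<^sub>m (x \<circ>\<^sub>m p) \<in> ?I"
      using p(1) q(1) x by (intro map_comp_partial_injections)
    ultimately show "z \<in> \<phi> ` ?I" by blast
  qed
  ultimately have "bij_betw \<phi> ?I ?L" by (simp add: bij_betw_def)
  \<comment> \<open>Reassociating \<open>(p x q) (p y q)\<close> exposes the middle factor
    \<open>q p\<close>, the element defining the variant.\<close>
  moreover have "\<phi> (x \<circ>\<^sub>m (q \<circ>\<^sub>m p) \<circ>\<^sub>m y) = \<phi> x \<circ>\<^sub>m \<phi> y" for x y
    by (simp only: \<phi>_def map_comp_assoc)
  ultimately have "\<phi> \<in> iso (variant (IS k) (q \<circ>\<^sub>m p)) (local_subsemigroup (IS m) (p \<circ>\<^sub>m q))"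
    by (auto simp: iso_def hom_def variant_def local_subsemigroup_def mult_IS carrier_IS
        dest: bij_betwE)
  then show ?thesis by (auto simp: is_iso_def)
qed

text \<open>The form needed for the first claim. The variant is closed because \<open>q p\<close>
  lies in \<open>IS k\<close>, so the isomorphism can be inverted.\<close>

lemma local_iso_variant: "local_subsemigroup (IS m) (p \<circ>\<^sub>m q) \<cong> variant (IS k) (q \<circ>\<^sub>m p)"
proof (rule semigroup_iso_sym[OF variant_iso_local])
  fix x y
  assume "x \<in> carrier (variant (IS k) (q \<circ>\<^sub>m p))" "y \<in> carrier (variant (IS k) (q \<circ>\<^sub>m p))"
  then have "x \<circ>\<^sub>m (q \<circ>\<^sub>m p) \<circ>\<^sub>m y \<in> carrier (IS k)"
    using inner_product_closed
    by (simp add: variant_def monoid.m_closed[OF monoid_IS] flip: mult_IS[where k = k])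
  then show "x \<otimes>\<^bsub>variant (IS k) (q \<circ>\<^sub>m p)\<^esub> y \<in> carrier (variant (IS k) (q \<circ>\<^sub>m p))"
    by (simp add: variant_def mult_IS)
qed

end

section \<open>Two ways of factoring \<alpha>\<close>

lemma factorization_through_rank:
  assumes "\<alpha> \<in> carrier (IS n)"
  obtains p q where "factorization (rank \<alpha>) n p q" "\<alpha> = p \<circ>\<^sub>m q"
proof -
  have \<alpha>: "\<alpha> \<in> partial_injections {1..n} {1..n}" "ran \<alpha> \<subseteq> {1..n}"
    using assms by (auto simp: carrier_IS partial_injections_def)
  then obtain h where h: "bij_betw h {1..rank \<alpha>} (ran \<alpha>)"
    unfolding rank_def using ex_bij_betw_nat_finite_1 finite_subset finite_atLeastAtMost by metis
  \<comment> \<open>\<open>p\<close> enumerates the range of \<alpha>, and \<open>q\<close> follows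
    \<alpha> by the inverse enumeration; hence \<open>p q\<close> is \<alpha> followed by the
    identity on its own range.\<close>
  define p where "p = (\<lambda>i. Some (h i)) |` {1..rank \<alpha>}"
  define q where "q = map_inverse p \<circ>\<^sub>m \<alpha>"
  have p_Some: "p i = Some y \<longleftrightarrow> i \<in> {1..rank \<alpha>} \<and> h i = y" for i y
    by (auto simp: p_def restrict_map_def)
  have dom_p: "dom p = {1..rank \<alpha>}" by (auto simp: p_def restrict_map_def dom_def)
  have ran_p: "ran p = ran \<alpha>"
  proof -
    have "ran p = h ` {1..rank \<alpha>}" by (auto simp: ran_def p_Some)
    with h show ?thesis by (simp add: bij_betw_def)
  qed
  have p: "p \<in> partial_injections {1..rank \<alpha>} {1..n}"
    unfolding partial_injections_iff
  proof (intro conjI allI impI)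
    fix x y assume xy: "p x = Some y"
    then show "x \<in> {1..rank \<alpha>}" by (simp add: p_Some)
    show "y \<in> {1..n}" using ranI[of p, OF xy] ran_p \<alpha>(2) by auto
  next
    fix x x' y assume "p x = Some y" "p x' = Some y"
    then show "x = x'"
      unfolding p_Some by (metis bij_betw_imp_inj_on[OF h] inj_onD)
  qed
  have q: "q \<in> partial_injections {1..n} {1..rank \<alpha>}"
    unfolding q_def using map_inverse_partial_injections[OF p] \<alpha>(1)
    by (rule map_comp_partial_injections)
  have "dom (map_inverse p) \<subseteq> ran \<alpha>"
    by (simp add: dom_map_inverse ran_p)
  then have "ran q = ran (map_inverse p)"
    unfolding q_def by (rule ran_comp_surjection)
  also have "\<dots> = dom p"
    unfolding ran_def dom_def map_inverse_eq_Some_iff[OF p] by auto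
  finally have "ran q = {1..rank \<alpha>}" using dom_p by simp
  then have "factorization (rank \<alpha>) n p q"
    using p dom_p q by unfold_locales
  moreover have "p \<circ>\<^sub>m q = \<alpha>"
    unfolding q_def map_comp_assoc[symmetric] map_comp_map_inverse_right[OF p] ran_p
    by (simp add: map_comp_restrict_left)
  ultimately show ?thesis using that by blast
qed

text \<open>Precomposing with the inclusion \<open>p\<close> forgets the points above
  \<open>n\<close>, so \<open>q\<close> may be prescribed freely there to become onto while
  \<open>q p\<close> stays \<alpha>.\<close>

lemma cofactorization_through_complement:
  assumes "\<alpha> \<in> carrier (IS n)"
  obtains p q where "factorization n (2 * n - rank \<alpha>) p q" "\<alpha> = q \<circ>\<^sub>m p"
proof -
  have \<alpha>: "\<alpha> \<in> partial_injections {1..n} {1..n}" "dom \<alpha> \<subseteq> {1..n}" "ran \<alpha> \<subseteq> {1..n}"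
    using assms by (auto simp: carrier_IS partial_injections_def)
  have le: "rank \<alpha> \<le> n"
    using card_mono[OF _ \<alpha>(3)] by (simp add: rank_def)
  let ?m = "2 * n - rank \<alpha>"
  \<comment> \<open>Here \<open>2 * n - rank \<alpha>\<close> is explained: it adds exactly one new
    point for each of the \<open>n - rank \<alpha>\<close> values that \<alpha> misses.\<close>
  have "card {n+1..?m} = card ({1..n} - ran \<alpha>)"
    using le \<alpha>(3) by (simp add: card_Diff_subset finite_subset rank_def)
  then obtain g where g: "bij_betw g {n+1..?m} ({1..n} - ran \<alpha>)"
    using finite_same_card_bij by blast
  define p where "p = (Some |` {1..n} :: nat \<rightharpoonup> nat)"
  define q where "q x = (if x \<in> {n+1..?m} then Some (g x) else \<alpha> x)" for x
  have g_props: "g x \<in> {1..n}" "g x \<notin> ran \<alpha>" if "x \<in> {n+1..?m}" for x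
    using bij_betwE[OF g] that by auto
  have g_inj: "x = y" if "x \<in> {n+1..?m}" "y \<in> {n+1..?m}" "g x = g y" for x y
    using g that by (meson bij_betw_def inj_onD)
  have p: "p \<in> partial_injections {1..n} {1..?m}" "dom p = {1..n}"
    using le by (auto simp: partial_injections_iff p_def restrict_map_def split: if_splits)
  have q_Some: "q x = Some y \<longleftrightarrow> x \<in> {n+1..?m} \<and> y = g x \<or> x \<notin> {n+1..?m} \<and> \<alpha> x = Some y" for x y
    by (auto simp: q_def)
  have q: "q \<in> partial_injections {1..?m} {1..n}"
    unfolding partial_injections_iff
  proof (intro conjI allI impI)
    fix x y assume "q x = Some y"
    then consider "x \<in> {n+1..?m}" "y = g x" | "\<alpha> x = Some y"
      unfolding q_Some by blast
    then have "x \<in> {1..?m} \<and> y \<in> {1..n}"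
    proof cases
      case 1 then show ?thesis using g_props(1) by auto
    next
      case 2
      then have "x \<in> {1..n}" "y \<in> {1..n}"
        using \<alpha>(1) unfolding partial_injections_iff by blast+
      then show ?thesis using le by auto
    qed
    then show "x \<in> {1..?m}" "y \<in> {1..n}" by auto
  next
    \<comment> \<open>Old and new points cannot collide, since \<open>g\<close> takes values outside
      \<open>ran \<alpha>\<close>; within each kind, injectivity of \<alpha> or of \<open>g\<close>
      applies.\<close>
    fix x x' y assume "q x = Some y" "q x' = Some y"
    then show "x = x'"
      using g_props(2) g_inj \<alpha>(1) unfolding q_Some partial_injections_iff
      by (metis ranI)
  qed
  have "{1..n} \<subseteq> ran q"
  proof
    fix y assume y: "y \<in> {1..n}"
    show "y \<in> ran q"
    proof (cases "y \<in> ran \<alpha>")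
      case True
      then obtain x where x: "\<alpha> x = Some y" by (auto simp: ran_def)
      then have "x \<in> {1..n}" using \<alpha>(2) by auto
      with x have "q x = Some y" by (simp add: q_def)
      then show ?thesis by (rule ranI)
    next
      case False
      then obtain x where "x \<in> {n+1..?m}" "g x = y"
        using g y by (metis DiffI bij_betw_def imageE)
      then have "q x = Some y" by (simp add: q_def)
      then show ?thesis by (rule ranI)
    qed
  qed
  then have "ran q = {1..n}"
    using q by (auto simp: partial_injections_def)
  then have "factorization n ?m p q"
    using p q by unfold_locales
  moreover have "\<alpha> = q \<circ>\<^sub>m p"
  proof
    fix x
    show "\<alpha> x = (q \<circ>\<^sub>m p) x"
      using \<alpha>(2) by (cases "x \<in> {1..n}") (auto simp: p_def q_def map_comp_def)
  qed
  ultimately show ?thesis by (rule that)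
qed

theorem theorem2:
  fixes n r :: nat and \<alpha> :: "nat \<rightharpoonup> nat"
  assumes "n > 0"
    and "\<alpha> \<in> carrier (IS n)"
    and "rank \<alpha> = r"
  shows "(\<exists>c \<in> carrier (IS r).
           rank c = rank (\<alpha> \<otimes>\<^bsub>IS n\<^esub> \<alpha>) \<and>
           local_subsemigroup (IS n) \<alpha> \<cong> variant (IS r) c) \<and>
         (\<exists>\<beta> \<in> carrier (IS (2 * n - r)).
           rank \<beta> = n \<and>
           rank (\<beta> \<otimes>\<^bsub>IS (2 * n - r)\<^esub> \<beta>) = r \<and>
           variant (IS n) \<alpha> \<cong> local_subsemigroup (IS (2 * n - r)) \<beta>)"
proof
  \<comment> \<open>Now \<alpha> is the outer product and \<open>c\<close> is the inner product
    \<open>q p\<close>, whose rank equals that of the square of \<alpha>.\<close>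
  obtain p q where pq: "factorization r n p q" and \<alpha>: "\<alpha> = p \<circ>\<^sub>m q"
    by (rule factorization_through_rank[OF assms(2), unfolded assms(3)])
  interpret factorization r n p q by (rule pq)
  show "\<exists>c \<in> carrier (IS r). rank c = rank (\<alpha> \<otimes>\<^bsub>IS n\<^esub> \<alpha>) \<and>
      local_subsemigroup (IS n) \<alpha> \<cong> variant (IS r) c"
    using inner_product_closed rank_outer_product_square local_iso_variant
    by (intro bexI[of _ "q \<circ>\<^sub>m p"]) (simp_all add: \<alpha> mult_IS)
next
  \<comment> \<open>The roles are exchanged: \<alpha> is the inner product and \<beta> the outer
    product \<open>p q\<close>, whose square has the rank of \<alpha>.\<close>
  obtain p q where pq: "factorization n (2 * n - r) p q" and \<alpha>: "\<alpha> = q \<circ>\<^sub>m p"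
    by (rule cofactorization_through_complement[OF assms(2), unfolded assms(3)])
  interpret factorization n "2 * n - r" p q by (rule pq)
  show "\<exists>\<beta> \<in> carrier (IS (2 * n - r)). rank \<beta> = n \<and>
      rank (\<beta> \<otimes>\<^bsub>IS (2 * n - r)\<^esub> \<beta>) = r \<and>
      variant (IS n) \<alpha> \<cong> local_subsemigroup (IS (2 * n - r)) \<beta>"
    using outer_product_closed rank_outer_product rank_outer_product_square variant_iso_local
      assms(3)
    by (intro bexI[of _ "p \<circ>\<^sub>m q"]) (simp_all add: \<alpha> mult_IS)
qed

end
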